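(* Let $G$ be a graph with $n$ vertices, $m$ edges, and chromatic number $k$. Then $Z_{DP}(G) \leq 3m$. Moreover, if $\delta(G) \geq k-1$, then $$Z_{DP}(G) \leq 3m - \frac{3}{2}(k-1)n.$$
   Context: All graphs are finite, undirected and simple. $\delta(G)$ is the minimum degree of $G$ and $\chi(G)$ its chromatic number. For a graph $G$ and $s \in \mathbb{N}$, $\mathcal{J}(G,s)$ denotes the join of $G$ with a copy of $K_s$: the graph obtained from $G$ by adding $s$ new vertices adjacent to every vertex of $G$ and to each other. A cover of a graph $G$ is a pair $(L,H)$, where $H$ is a graph and $L\colon V(G)\to 2^{V(H)}$, such that: the sets $L(u)$, $u\in V(G)$, partition $V(H)$; if $u,v\in V(G)$ and some vertex of $L(v)$ is adjacent in $H$ to some vertex of $L(u)$, then $v=u$ or $uv\in E(G)$; each $H[L(u)]$ is a complete graph; and if $uv\in E(G)$, then the set of edges of $H$ between $L(u)$ and $L(v)$ is a matching (possibly empty, not necessarily perfect). An $(L,H)$-coloring of $G$ is an independent set $I$ of $H$ with $|I\cap L(u)|=1$ for all $u\in V(G)$. The DP-chromatic number $\chi_{DP}(G)$ is the smallest $k\in\mathbb{N}$ such that $G$ is $(L,H)$-colorable for every cover $(L,H)$ with $|L(u)|\ge k$ for all $u\in V(G)$. Define $Z_{DP}(G) := \min\{ s\in \mathbb{N} : \chi_{DP}(\mathcal{J}(G,s)) = \chi(\mathcal{J}(G,s))\}$. *)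

theory Defs
  imports Complex_Main "HOL-Library.Disjoint_Sets"
begin

record 'a ugraph =
  verts :: "'a set"
  edges :: "'a set set"

definition simple_graph :: "'a ugraph \<Rightarrow> bool" where
  "simple_graph G \<longleftrightarrow> finite (verts G) \<and> (\<forall>e\<in>edges G. e \<subseteq> verts G \<and> card e = 2)"

definition degree :: "'a ugraph \<Rightarrow> 'a \<Rightarrow> nat" where
  "degree G v = card {e \<in> edges G. v \<in> e}"

text \<open>Unspecified for the graph without vertices.\<close>

definition min_degree :: "'a ugraph \<Rightarrow> nat" where
  "min_degree G = Min (degree G ` verts G)"

definition colorable :: "'a ugraph \<Rightarrow> nat \<Rightarrow> bool" where
  "colorable G k \<longleftrightarrow>
     (\<exists>f :: 'a \<Rightarrow> nat. (\<forall>v\<in>verts G. f v < k) \<and> (\<forall>u v. {u, v} \<in> edges G \<longrightarrow> f u \<noteq> f v))"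

definition chromatic_number :: "'a ugraph \<Rightarrow> nat" where
  "chromatic_number G = (LEAST k. colorable G k)"

definition join_complete :: "'a ugraph \<Rightarrow> nat \<Rightarrow> ('a + nat) ugraph" where
  "join_complete G s =
     \<lparr> verts = Inl ` verts G \<union> Inr ` {..<s},
       edges = (\<lambda>e. Inl ` e) ` edges G
             \<union> {{Inl v, Inr i} | v i. v \<in> verts G \<and> i < s}
             \<union> {{Inr i, Inr j} | i j. i < s \<and> j < s \<and> i \<noteq> j} \<rparr>"

definition edges_between :: "'b ugraph \<Rightarrow> 'b set \<Rightarrow> 'b set \<Rightarrow> 'b set set" where
  "edges_between H A B = {{x, y} | x y. x \<in> A \<and> y \<in> B \<and> {x, y} \<in> edges H}"

text \<open>
  The sets \<open>L u\<close> partition the vertices of \<open>H\<close>, but some of them may be empty: this is what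
  excludes \<open>0\<close> as a DP-chromatic number of a graph with at least one vertex.  For a set
  of edges, being a matching means that distinct edges share no vertex.
\<close>

definition cover :: "'a ugraph \<Rightarrow> ('a \<Rightarrow> 'b set) \<Rightarrow> 'b ugraph \<Rightarrow> bool" where
  "cover G L H \<longleftrightarrow>
     simple_graph H \<and>
     (\<Union>u\<in>verts G. L u) = verts H \<and> disjoint_family_on L (verts G) \<and>
     (\<forall>u\<in>verts G. \<forall>v\<in>verts G.
        (\<exists>x\<in>L u. \<exists>y\<in>L v. {x, y} \<in> edges H) \<longrightarrow> v = u \<or> {u, v} \<in> edges G) \<and>
     (\<forall>u\<in>verts G. \<forall>x\<in>L u. \<forall>y\<in>L u. x \<noteq> y \<longrightarrow> {x, y} \<in> edges H) \<and>
     (\<forall>u v. {u, v} \<in> edges G \<longrightarrow> disjoint (edges_between H (L u) (L v)))"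

definition independent_set :: "'b ugraph \<Rightarrow> 'b set \<Rightarrow> bool" where
  "independent_set H I \<longleftrightarrow> I \<subseteq> verts H \<and> (\<forall>x\<in>I. \<forall>y\<in>I. {x, y} \<notin> edges H)"

definition cover_coloring :: "'a ugraph \<Rightarrow> ('a \<Rightarrow> 'b set) \<Rightarrow> 'b ugraph \<Rightarrow> 'b set \<Rightarrow> bool" where
  "cover_coloring G L H I \<longleftrightarrow> independent_set H I \<and> (\<forall>u\<in>verts G. card (I \<inter> L u) = 1)"

text \<open>
  Since all graphs are finite, every cover is isomorphic to one whose graph \<open>H\<close> has natural
  numbers as vertices, so the quantification over \<^typ>\<open>nat ugraph\<close> loses no covers.
\<close>

definition DP_colorable :: "'a ugraph \<Rightarrow> nat \<Rightarrow> bool" where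
  "DP_colorable G k \<longleftrightarrow>
     (\<forall>(L :: 'a \<Rightarrow> nat set) (H :: nat ugraph).
        cover G L H \<and> (\<forall>u\<in>verts G. k \<le> card (L u)) \<longrightarrow> (\<exists>I. cover_coloring G L H I))"

definition DP_chromatic_number :: "'a ugraph \<Rightarrow> nat" where
  "DP_chromatic_number G = (LEAST k. DP_colorable G k)"

definition Z_DP :: "'a ugraph \<Rightarrow> nat" where
  "Z_DP G = (LEAST s. DP_chromatic_number (join_complete G s) = chromatic_number (join_complete G s))"

end

theory Submission
  imports Defs "HOL-Library.Nat_Bijection"
begin

text \<open>
  Let \<open>A\<close> be the added clique and \<open>V\<close> the vertex set of \<open>G\<close>.  The excess of \<open>v \<in> V\<close> is the
  amount by which \<open>|L v|\<close> falls short of what greedy colouring needs.  If every list of \<open>A\<close> has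
  at least \<open>|A| + k\<close> elements and \<open>|A|\<close> is at least 3/2 of the total excess (up to rounding), a
  colouring exists, by induction on the number of vertices.  In a minimal counterexample no
  one, two or three clique vertices can be coloured so that the excess drops by at least 2/3 of
  their number, which forces the matchings between the lists of \<open>A\<close> and \<open>V\<close> to be nearly parallel.
  Then, for some \<open>y\<close> in the list of a clique vertex, the neighbours of \<open>y\<close> can be chosen on a
  whole colour class of \<open>G\<close>; \<open>k\<close> drops by one, and the few clique vertices that lose more than one
  element of their list are coloured next, paid for by the excess of the class.
\<close>

section \<open>Choosing independent representatives from lists\<close>

text \<open>An abstract cover: \<open>R\<close> is adjacency between list elements, \<open>E\<close>
  is adjacency in the graph outside the clique, and \<open>col\<close> is a proper colouring of that
  graph.\<close>

locale list_conflicts =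
  fixes R :: "'b \<Rightarrow> 'b \<Rightarrow> bool" and E :: "'a \<Rightarrow> 'a \<Rightarrow> bool" and col :: "'a \<Rightarrow> 'c"
  assumes R_sym: "R x y \<Longrightarrow> R y x"
    and E_sym: "E u v \<Longrightarrow> E v u"
    and col: "E u v \<Longrightarrow> col u \<noteq> col v"
begin

section \<open>Matched lists, transversals and residual lists\<close>

definition matched :: "'a set \<Rightarrow> ('a \<Rightarrow> 'b set) \<Rightarrow> bool" where
  "matched T L \<longleftrightarrow> finite T \<and> (\<forall>t\<in>T. finite (L t)) \<and>
     (\<forall>t\<in>T. \<forall>t'\<in>T. t \<noteq> t' \<longrightarrow>
        (\<forall>x\<in>L t. \<forall>y\<in>L t'. \<forall>y'\<in>L t'. R x y \<longrightarrow> R x y' \<longrightarrow> y = y'))"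

definition transversal :: "'a set \<Rightarrow> ('a \<Rightarrow> 'b set) \<Rightarrow> ('a \<Rightarrow> 'b) \<Rightarrow> bool" where
  "transversal T L f \<longleftrightarrow>
     (\<forall>t\<in>T. f t \<in> L t) \<and> (\<forall>t\<in>T. \<forall>t'\<in>T. t \<noteq> t' \<longrightarrow> \<not> R (f t) (f t'))"

definition residual :: "('a \<Rightarrow> 'b set) \<Rightarrow> 'a set \<Rightarrow> ('a \<Rightarrow> 'b) \<Rightarrow> 'a \<Rightarrow> 'b set" where
  "residual L S g t = {x \<in> L t. \<forall>s\<in>S. \<not> R (g s) x}"

definition deg :: "'a set \<Rightarrow> 'a \<Rightarrow> nat" where
  "deg V v = card {u \<in> V. E v u}"

text \<open>Truncated subtraction is intended: this is the positive part.\<close>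

definition excess :: "'a set \<Rightarrow> 'a set \<Rightarrow> ('a \<Rightarrow> 'b set) \<Rightarrow> 'a \<Rightarrow> nat" where
  "excess A V L v = deg V v + card A + 1 - card (L v)"

text \<open>The hypothesis of the induction. Only pairs inside \<open>V\<close> are tied to
  \<open>E\<close>, so clique vertices may conflict with everything. The last inequality says that
  \<open>card A\<close> is at least 3/2 of the total excess, rounded down.\<close>

definition admissible :: "'a set \<Rightarrow> 'a set \<Rightarrow> ('a \<Rightarrow> 'b set) \<Rightarrow> bool" where
  "admissible A V L \<longleftrightarrow> matched (A \<union> V) L \<and> A \<inter> V = {} \<and>
     (\<forall>u\<in>V. \<forall>v\<in>V. u \<noteq> v \<longrightarrow> (\<forall>x\<in>L u. \<forall>y\<in>L v. R x y \<longrightarrow> E u v)) \<and>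
     (\<forall>a\<in>A. card A + card (col ` V) \<le> card (L a)) \<and>
     3 * (\<Sum>v\<in>V. excess A V L v) \<le> 2 * card A + 1"

lemma matchedD:
  "\<lbrakk>matched T L; t \<in> T; t' \<in> T; t \<noteq> t'; x \<in> L t; y \<in> L t'; y' \<in> L t'; R x y; R x y'\<rbrakk> \<Longrightarrow> y = y'"
  unfolding matched_def by blast

lemma matched_mono:
  assumes "matched T L" "T' \<subseteq> T" "\<And>t. t \<in> T' \<Longrightarrow> L' t \<subseteq> L t"
  shows "matched T' L'"
proof -
  have "finite T'" using assms(1,2) unfolding matched_def by (auto intro: finite_subset)
  moreover have "\<forall>t\<in>T'. finite (L' t)"
    using assms unfolding matched_def by (meson finite_subset subsetD)
  moreover have "\<forall>t\<in>T'. \<forall>t'\<in>T'. t \<noteq> t' \<longrightarrow>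
        (\<forall>x\<in>L' t. \<forall>y\<in>L' t'. \<forall>y'\<in>L' t'. R x y \<longrightarrow> R x y' \<longrightarrow> y = y')"
    using assms matchedD[OF assms(1)] by (meson subsetD)
  ultimately show ?thesis unfolding matched_def by blast
qed

lemma residual_subset: "residual L S g t \<subseteq> L t"
  unfolding residual_def by blast

lemma transversal_combine:
  assumes "transversal S L g" "transversal (T - S) (residual L S g) f" "S \<subseteq> T"
  shows "transversal T L (\<lambda>t. if t \<in> S then g t else f t)"
  unfolding transversal_def
proof (intro conjI ballI impI)
  fix t t' assume t: "t \<in> T" "t' \<in> T" "t \<noteq> t'"
  show "\<not> R (if t \<in> S then g t else f t) (if t' \<in> S then g t' else f t')"
  proof (cases "t \<in> S")
    case True
    then show ?thesis using assms t unfolding transversal_def residual_def by auto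
  next
    case False
    then have "f t \<in> residual L S g t" using assms t unfolding transversal_def by blast
    then show ?thesis
      using False assms t R_sym[of "f t" "g t'"] unfolding transversal_def residual_def by auto
  qed
qed (use assms in \<open>auto simp: transversal_def residual_def\<close>)

lemma card_neighbours_le_1:
  assumes "matched T L" "s \<in> T" "t \<in> T" "s \<noteq> t" "x \<in> L s"
  shows "card {y \<in> L t. R x y} \<le> 1"
proof -
  have "finite {y \<in> L t. R x y}" using assms unfolding matched_def by auto
  then show ?thesis
    using matchedD[OF assms(1-4) assms(5)] by (auto simp: card_le_Suc0_iff_eq)
qed

text \<open>Each representative deletes at most one element of another list, so the loss is at most
  the size of any \<open>S'\<close> whose representatives account for all deletions. When deletions
  coincide, a small \<open>S'\<close> suffices; the gains in later steps arise in this way.\<close>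

lemma card_list_le_residual:
  assumes M: "matched T L" and "t \<in> T" "t \<notin> S" "S' \<subseteq> S" "S \<subseteq> T"
    and g: "\<And>s. s \<in> S' \<Longrightarrow> g s \<in> L s"
    and dom: "\<And>s x. \<lbrakk>s \<in> S; x \<in> L t; R (g s) x\<rbrakk> \<Longrightarrow> \<exists>s'\<in>S'. R (g s') x"
  shows "card (L t) \<le> card (residual L S g t) + card S'"
proof -
  have "S' \<subseteq> T" using assms by blast
  then have fin: "finite S'" "finite (L t)"
    using M \<open>t \<in> T\<close> unfolding matched_def by (auto intro: finite_subset)
  have "L t \<subseteq> residual L S g t \<union> (\<Union>s\<in>S'. {x \<in> L t. R (g s) x})"
    unfolding residual_def using dom by blast
  then have "card (L t) \<le> card (residual L S g t \<union> (\<Union>s\<in>S'. {x \<in> L t. R (g s) x}))"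
    using fin by (intro card_mono) (auto simp: residual_def)
  also have "\<dots> \<le> card (residual L S g t) + card (\<Union>s\<in>S'. {x \<in> L t. R (g s) x})"
    by (rule card_Un_le)
  also have "card (\<Union>s\<in>S'. {x \<in> L t. R (g s) x}) \<le> (\<Sum>s\<in>S'. card {x \<in> L t. R (g s) x})"
    using fin by (intro card_UN_le)
  also have "\<dots> \<le> (\<Sum>s\<in>S'. 1)"
  proof (rule sum_mono)
    fix s assume "s \<in> S'"
    then show "card {x \<in> L t. R (g s) x} \<le> 1"
      using \<open>S' \<subseteq> T\<close> assms(2-4) g by (intro card_neighbours_le_1[OF M, of s]) auto
  qed
  finally show ?thesis by simp
qed

text \<open>Colouring one vertex deletes at most one element from every other list, while the number
  of vertices left falls by one.\<close>

lemma greedy: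
  assumes "finite D" "matched D L" "\<And>d. d \<in> D \<Longrightarrow> card D \<le> card (L d)"
  shows "\<exists>f. transversal D L f"
  using assms
proof (induction D arbitrary: L rule: finite_induct)
  case empty
  then show ?case by (auto simp: transversal_def)
next
  case (insert d D)
  have "card (L d) \<noteq> 0" using insert.prems(2)[of d] insert.hyps by auto
  then obtain x where x: "x \<in> L d" by fastforce
  let ?L = "residual L {d} (\<lambda>_. x)"
  have "card D \<le> card (?L e)" if "e \<in> D" for e
  proof -
    have "card (L e) \<le> card (?L e) + card {d}"
      using insert.prems that insert.hyps x
      by (intro card_list_le_residual[where T = "insert d D"]) auto
    then show ?thesis using insert.prems(2)[of e] insert.hyps that by simp
  qed
  moreover have "matched D ?L"
    using insert.prems(1) by (rule matched_mono) (auto simp: residual_def)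
  ultimately obtain f where "transversal D ?L f" using insert.IH by blast
  moreover have "insert d D - {d} = D" using insert.hyps by auto
  moreover have "transversal {d} L (\<lambda>_. x)" using x by (simp add: transversal_def)
  ultimately show ?case using transversal_combine[of "{d}" L "\<lambda>_. x" "insert d D" f] by auto
qed

text \<open>A vertex of excess 0 can wait until last: its list is longer than the number of possible
  deletions, one for each vertex of \<open>A\<close> and each neighbour in \<open>V\<close>.\<close>

lemma extend_to_vertex:
  assumes M: "matched (A \<union> V) L" and AV: "A \<inter> V = {}" and v: "v \<in> V"
    and E: "\<And>u x y. \<lbrakk>u \<in> V; u \<noteq> v; x \<in> L u; y \<in> L v; R x y\<rbrakk> \<Longrightarrow> E u v"
    and size: "excess A V L v = 0"
    and f: "transversal (A \<union> (V - {v})) L f"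
  shows "\<exists>f. transversal (A \<union> V) L f"
proof -
  let ?S = "A \<union> (V - {v})" and ?S' = "A \<union> {u \<in> V - {v}. E v u}"
  have fin: "finite A" "finite V" using M unfolding matched_def by auto
  have "card (L v) \<le> card (residual L ?S f v) + card ?S'"
  proof (rule card_list_le_residual[OF M])
    fix s x assume "s \<in> ?S" "x \<in> L v" "R (f s) x"
    moreover from this have "f s \<in> L s" using f by (auto simp: transversal_def)
    ultimately have "s \<in> ?S'" using E E_sym by auto
    then show "\<exists>s'\<in>?S'. R (f s') x" using \<open>R (f s) x\<close> by blast
  qed (use AV v f in \<open>auto simp: transversal_def\<close>)
  moreover have "card ?S' \<le> card A + deg V v"
  proof -
    have "card ?S' \<le> card A + card {u \<in> V - {v}. E v u}" by (rule card_Un_le)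
    also have "card {u \<in> V - {v}. E v u} \<le> deg V v"
      unfolding deg_def using fin by (intro card_mono) auto
    finally show ?thesis by simp
  qed
  ultimately have "card (residual L ?S f v) \<noteq> 0" using size by (simp add: excess_def)
  then obtain x where x: "x \<in> residual L ?S f v" by fastforce
  have "transversal (A \<union> V - ?S) (residual L ?S f) (\<lambda>_. x)"
    using AV v x by (auto simp: transversal_def)
  from transversal_combine[OF f this] show ?thesis by blast
qed

lemma deg_mono: "\<lbrakk>finite V; W \<subseteq> V\<rbrakk> \<Longrightarrow> deg W v \<le> deg V v"
  unfolding deg_def by (intro card_mono) auto

end

section \<open>A minimal counterexample\<close>

locale critical = list_conflicts R E col
  for R :: "'b \<Rightarrow> 'b \<Rightarrow> bool" and E :: "'a \<Rightarrow> 'a \<Rightarrow> bool" and col :: "'a \<Rightarrow> 'c" +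
  fixes A V :: "'a set" and L :: "'a \<Rightarrow> 'b set"
  assumes adm: "admissible A V L"
    and no_transversal: "\<not> (\<exists>f. transversal (A \<union> V) L f)"
    and smaller: "\<lbrakk>admissible A' V' L'; card A' + card V' < card A + card V\<rbrakk>
      \<Longrightarrow> \<exists>f. transversal (A' \<union> V') L' f"
begin

section \<open>First properties of a minimal counterexample\<close>

abbreviation exc :: "'a \<Rightarrow> nat" where
  "exc \<equiv> excess A V L"

lemma M: "matched (A \<union> V) L"
  and AV: "A \<inter> V = {}"
  and EV: "\<lbrakk>u \<in> V; v \<in> V; u \<noteq> v; x \<in> L u; y \<in> L v; R x y\<rbrakk> \<Longrightarrow> E u v"
  and LA: "a \<in> A \<Longrightarrow> card A + card (col ` V) \<le> card (L a)"
  and budget: "3 * (\<Sum>v\<in>V. exc v) \<le> 2 * card A + 1"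
  using adm unfolding admissible_def by blast+

lemma fin: "finite A" "finite V" "t \<in> A \<union> V \<Longrightarrow> finite (L t)"
  using M unfolding matched_def by auto

lemma admissible_restrict:
  assumes "A' \<subseteq> A" "V' \<subseteq> V" "\<And>t. L' t \<subseteq> L t"
    and "\<And>a. a \<in> A' \<Longrightarrow> card A' + card (col ` V') \<le> card (L' a)"
    and "3 * (\<Sum>v\<in>V'. excess A' V' L' v) \<le> 2 * card A' + 1"
  shows "admissible A' V' L'"
proof -
  have "matched (A' \<union> V') L'"
    by (rule matched_mono[OF M]) (use assms in auto)
  then show ?thesis
    unfolding admissible_def using assms AV EV by (meson disjoint_iff subsetD)
qed

text \<open>A vertex of excess 0 could be removed, the rest coloured by minimality, and the vertex
  coloured last.\<close>

lemma excess_pos: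
  assumes "v \<in> V" shows "exc v > 0"
proof (rule ccontr)
  assume "\<not> exc v > 0"
  then have zero: "exc v = 0" by simp
  have "card (V - {v}) < card V" using assms fin by (intro psubset_card_mono) auto
  moreover have "admissible A (V - {v}) L"
  proof (rule admissible_restrict)
    fix a assume "a \<in> A"
    have "card (col ` (V - {v})) \<le> card (col ` V)" using fin by (intro card_mono) auto
    then show "card A + card (col ` (V - {v})) \<le> card (L a)" using LA[OF \<open>a \<in> A\<close>] by simp
  next
    have "(\<Sum>u\<in>V - {v}. excess A (V - {v}) L u) \<le> (\<Sum>u\<in>V - {v}. exc u)"
      using deg_mono[of V "V - {v}"] fin
      by (intro sum_mono) (simp add: excess_def diff_le_mono)
    also have "\<dots> \<le> (\<Sum>u\<in>V. exc u)" using fin by (intro sum_mono2) auto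
    finally show "3 * (\<Sum>u\<in>V - {v}. excess A (V - {v}) L u) \<le> 2 * card A + 1"
      using budget by simp
  qed auto
  ultimately obtain f where "transversal (A \<union> (V - {v})) L f" using smaller by fastforce
  then show False
    using extend_to_vertex[OF M AV assms _ zero] EV[OF _ assms] no_transversal by blast
qed

lemma V_nonempty: "V \<noteq> {}"
proof
  assume "V = {}"
  then have "\<exists>f. transversal A L f" using greedy[of A L] M LA fin by auto
  then show False using no_transversal \<open>V = {}\<close> by simp
qed

lemma card_V_le: "card V \<le> (\<Sum>v\<in>V. exc v)"
  using sum_mono[of V "\<lambda>_. 1" exc] excess_pos by (simp add: Suc_le_eq)

lemma card_col_pos: "card (col ` V) > 0"
  using V_nonempty fin by (simp add: card_gt_0_iff)

lemma A_nonempty: "A \<noteq> {}"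
proof
  assume "A = {}"
  \<comment> \<open>With \<open>A\<close> empty the budget forces total excess 0, while every vertex
    of \<open>V\<close> contributes at least 1.\<close>
  then have "card V = 0" using budget card_V_le by simp
  then show False using V_nonempty fin by simp
qed

section \<open>Colouring a few clique vertices first\<close>

lemma A_step_lists:
  assumes "S \<subseteq> A" "transversal S L g" "a \<in> A - S"
  shows "card (A - S) + card (col ` V) \<le> card (residual L S g a)"
proof -
  have "card (L a) \<le> card (residual L S g a) + card S"
    using assms by (intro card_list_le_residual[OF M]) (auto simp: transversal_def)
  moreover have "card (A - S) = card A - card S" "card S \<le> card A"
    using assms(1) fin by (auto intro: card_Diff_subset finite_subset card_mono)
  ultimately show ?thesis using LA[of a] assms by simp
qed

text \<open>The list of \<open>v\<close> shrinks by \<open>h v\<close> less than the clique \<open>A\<close> does, which is a gain of \<open>h v\<close>.\<close>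

lemma A_step:
  assumes S: "S \<subseteq> A" "S \<noteq> {}" and g: "transversal S L g"
    and h: "\<And>v. v \<in> V \<Longrightarrow> h v \<le> exc v"
    and gain: "\<And>v. v \<in> V \<Longrightarrow> card (L v) + h v \<le> card (residual L S g v) + card S"
    and total: "3 * (\<Sum>v\<in>V. exc v) + 2 * card S \<le> 2 * card A + 1 + 3 * (\<Sum>v\<in>V. h v)"
  shows False
proof -
  have cS: "card (A - S) = card A - card S" "card S \<le> card A" "card S > 0"
    using S fin by (auto simp: card_gt_0_iff intro: card_Diff_subset finite_subset card_mono)
  have "admissible (A - S) V (residual L S g)"
  proof (rule admissible_restrict)
    \<comment> \<open>The bound \<open>h v \<le> exc v\<close> keeps truncated subtraction from
      swallowing part of the gain.\<close>
    have "(\<Sum>v\<in>V. excess (A - S) V (residual L S g) v + h v) \<le> (\<Sum>v\<in>V. exc v)"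
    proof (rule sum_mono)
      fix v assume "v \<in> V"
      then show "excess (A - S) V (residual L S g) v + h v \<le> exc v"
        using h[of v] gain[of v] cS unfolding excess_def by simp
    qed
    then show "3 * (\<Sum>v\<in>V. excess (A - S) V (residual L S g) v) \<le> 2 * card (A - S) + 1"
      using total cS by (simp add: sum.distrib)
  qed (use S A_step_lists[OF S(1) g] residual_subset in auto)
  then obtain f where "transversal (A - S \<union> V) (residual L S g) f"
    using smaller[of "A - S" V] cS by fastforce
  moreover have "A - S \<union> V = A \<union> V - S" using S AV by auto
  ultimately show False using transversal_combine[OF g, of "A \<union> V"] S no_transversal by fastforce
qed

text \<open>Otherwise the budget would survive the loss of one clique vertex without any gain, so a
  clique vertex could be coloured arbitrarily.\<close>

lemma no_slack: "2 * card A \<le> 3 * (\<Sum>v\<in>V. exc v)"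
proof (rule ccontr)
  assume neg: "\<not> ?thesis"
  obtain a where a: "a \<in> A" using A_nonempty by blast
  have "card (L a) \<noteq> 0" using LA[OF a] card_col_pos by simp
  then obtain x where x: "x \<in> L a" by fastforce
  show False
  proof (rule A_step[of "{a}" "\<lambda>_. x" "\<lambda>_. 0"])
    fix v assume "v \<in> V"
    then show "card (L v) + 0 \<le> card (residual L {a} (\<lambda>_. x) v) + card {a}"
      using card_list_le_residual[OF M, of v "{a}" "{a}" "\<lambda>_. x"] a x AV by auto
  qed (use a x neg in \<open>auto simp: transversal_def\<close>)
qed

text \<open>Choosing an \<open>x\<close> without neighbour in \<open>L v\<close> would leave that
  list intact: a gain of 1 for one clique vertex, above the required 2/3.\<close>

lemma neighbour_exists:
  assumes "a \<in> A" "x \<in> L a" "v \<in> V"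
  shows "\<exists>w\<in>L v. R x w"
proof (rule ccontr)
  assume none: "\<not> ?thesis"
  let ?h = "\<lambda>u. if u = v then 1 else 0 :: nat"
  have "(\<Sum>u\<in>V. ?h u) = 1" using assms fin by simp
  show False
  proof (rule A_step[of "{a}" "\<lambda>_. x" ?h])
    fix u assume u: "u \<in> V"
    then have "card (L u) \<le> card (residual L {a} (\<lambda>_. x) u) + card {a}"
      using card_list_le_residual[OF M, of u "{a}" "{a}" "\<lambda>_. x"] assms AV by auto
    moreover have "card (L v) \<le> card (residual L {a} (\<lambda>_. x) v) + card ({} :: 'a set)"
      using assms AV none by (intro card_list_le_residual[OF M]) auto
    ultimately show "card (L u) + ?h u \<le> card (residual L {a} (\<lambda>_. x) u) + card {a}" by auto
  next
    fix u assume "u \<in> V"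
    then show "?h u \<le> exc u" using excess_pos[of u] by (auto simp: Suc_le_eq)
  next
    show "3 * (\<Sum>v\<in>V. exc v) + 2 * card {a} \<le> 2 * card A + 1 + 3 * (\<Sum>u\<in>V. ?h u)"
      using budget \<open>(\<Sum>u\<in>V. ?h u) = 1\<close> by simp
  qed (use assms in \<open>auto simp: transversal_def\<close>)
qed

text \<open>Sending each element of a clique vertex's list to its neighbour in \<open>L v\<close> is
  injective by the matching property, so \<open>L v\<close> is at least as long as that
  list.\<close>

lemma card_list_ge:
  assumes "v \<in> V" shows "card A < card (L v)"
proof -
  obtain a where a: "a \<in> A" using A_nonempty by blast
  obtain nb where nb: "\<And>x. x \<in> L a \<Longrightarrow> nb x \<in> L v \<and> R x (nb x)"
    using neighbour_exists[OF a _ assms] by metis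
  have "inj_on nb (L a)"
  proof (rule inj_onI)
    fix x y assume "x \<in> L a" "y \<in> L a" "nb x = nb y"
    then show "x = y"
      using matchedD[OF M, of v a "nb x" x y] nb R_sym a assms AV by fastforce
  qed
  then have "card (L a) \<le> card (L v)"
    using nb fin assms by (intro card_inj_on_le) auto
  then show ?thesis using LA[OF a] card_col_pos by simp
qed

section \<open>Representatives with a common neighbour in a list\<close>

definition share :: "'a \<Rightarrow> 'b \<Rightarrow> 'b \<Rightarrow> bool" where
  "share v x y \<longleftrightarrow> (\<exists>w\<in>L v. R x w \<and> R y w)"

lemma share_iff:
  assumes "v \<in> V" "a \<in> A" "x \<in> L a" "share v x y" "w \<in> L v" "R x w"
  shows "R y w"
proof -
  obtain w' where "w' \<in> L v" "R x w'" "R y w'" using assms unfolding share_def by blast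
  moreover from this have "w' = w"
    using matchedD[OF M, of a v x w' w] assms AV by auto
  ultimately show ?thesis by simp
qed

lemma share_sym: "share v x y \<longleftrightarrow> share v y x"
  unfolding share_def by blast

text \<open>Coincidences at two vertices would gain 2 for two clique vertices, above the required
  4/3.\<close>

lemma share_unique:
  assumes ab: "a \<in> A" "b \<in> A" "a \<noteq> b" "x \<in> L a" "y \<in> L b" "\<not> R x y"
    and uv: "u \<in> V" "v \<in> V" "share u x y" "share v x y"
  shows "u = v"
proof (rule ccontr)
  assume "u \<noteq> v"
  let ?h = "\<lambda>t. if t = u then 1 else if t = v then 1 else 0 :: nat"
  let ?g = "\<lambda>t. if t = a then x else y"
  have sum_h: "(\<Sum>t\<in>V. ?h t) = 2"
  proof -
    have "(\<Sum>t\<in>V. ?h t) = (\<Sum>t\<in>{u, v}. ?h t)"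
      using fin uv by (intro sum.mono_neutral_right) auto
    then show ?thesis using \<open>u \<noteq> v\<close> by simp
  qed
  show False
  proof (rule A_step[of "{a, b}" ?g ?h])
    fix t assume t: "t \<in> V"
    have all: "card (L t) \<le> card (residual L {a, b} ?g t) + card {a, b}"
      using t ab AV by (intro card_list_le_residual[OF M]) auto
    have "card (L t) \<le> card (residual L {a, b} ?g t) + card {a}" if "share t x y"
      using t ab AV share_iff[of t b y x] that share_sym
      by (intro card_list_le_residual[OF M]) (auto split: if_splits)
    then show "card (L t) + ?h t \<le> card (residual L {a, b} ?g t) + card {a, b}"
      using all uv ab by auto
  next
    fix t assume "t \<in> V"
    then show "?h t \<le> exc t" using excess_pos[of t] by (auto simp: Suc_le_eq)
  next
    show "3 * (\<Sum>v\<in>V. exc v) + 2 * card {a, b} \<le> 2 * card A + 1 + 3 * (\<Sum>t\<in>V. ?h t)"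
      unfolding sum_h using budget ab by simp
  qed (use ab R_sym[of y x] in \<open>auto simp: transversal_def\<close>)
qed

text \<open>
  Two representatives sharing a neighbour at \<open>v\<close> bring the excess of \<open>v\<close> down to 0, so
  \<open>v\<close> can be coloured last; dropping it lowers the excess of its neighbours as well.
\<close>

lemma share_excess:
  assumes ab: "a \<in> A" "b \<in> A" "a \<noteq> b" "x \<in> L a" "y \<in> L b" "\<not> R x y"
    and v: "v \<in> V" "share v x y"
  shows "exc v \<ge> 2"
proof (rule ccontr)
  assume "\<not> exc v \<ge> 2"
  then have one: "exc v = 1" using excess_pos[OF v(1)] by simp
  \<comment> \<open>With excess 1 the degree equals \<open>card (L v) - card A\<close>, which is
    positive by \<open>card_list_ge\<close>.\<close>
  have "deg V v > 0" using one card_list_ge[OF v(1)] unfolding excess_def by simp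
  then obtain n where n: "n \<in> V" "E v n" unfolding deg_def by (auto simp: card_gt_0_iff)
  have "n \<noteq> v" using col n by blast
  let ?S = "{a, b}" and ?g = "\<lambda>t. if t = a then x else y"
  let ?L = "residual L ?S ?g" and ?W = "V - {v}"
  have g: "transversal ?S L ?g" using ab R_sym[of y x] by (auto simp: transversal_def)
  have cS: "card (A - ?S) = card A - 2" "2 \<le> card A"
    using ab fin card_mono[of A ?S] by (auto simp: card_Diff_subset)
  have all: "card (L t) \<le> card (?L t) + 2" if "t \<in> V" for t
  proof -
    have "card (L t) \<le> card (?L t) + card ?S"
      using that ab AV by (intro card_list_le_residual[OF M]) auto
    then show ?thesis using ab by simp
  qed
  have zero: "excess (A - ?S) V ?L v = 0"
  proof -
    have "card (L v) \<le> card (?L v) + card {a}"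
      using v ab AV share_iff[of v b y x] share_sym
      by (intro card_list_le_residual[OF M]) (auto split: if_splits)
    then show ?thesis using one cS unfolding excess_def by simp
  qed
  have "admissible (A - ?S) ?W ?L"
  proof (rule admissible_restrict)
    fix c assume "c \<in> A - ?S"
    moreover have "card (col ` ?W) \<le> card (col ` V)" using fin by (intro card_mono) auto
    ultimately show "card (A - ?S) + card (col ` ?W) \<le> card (?L c)"
      using A_step_lists[OF _ g, of c] ab by fastforce
  next
    let ?e = "\<lambda>t. excess (A - ?S) ?W ?L t"
    have le: "?e t \<le> exc t" if "t \<in> V" for t
      using all[OF that] deg_mono[of V ?W t] fin cS unfolding excess_def by simp
    have "deg ?W n < deg V n"
      unfolding deg_def using n v fin E_sym by (intro psubset_card_mono) auto
    then have "?e n < exc n"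
      using all[OF n(1)] excess_pos[OF n(1)] cS unfolding excess_def by simp
    then have "(\<Sum>t\<in>?W. ?e t) < (\<Sum>t\<in>?W. exc t)"
      using le n \<open>n \<noteq> v\<close> fin by (intro sum_strict_mono_ex1) auto
    moreover have "(\<Sum>t\<in>V. exc t) = exc v + (\<Sum>t\<in>?W. exc t)"
      using v fin by (simp add: sum.remove)
    \<comment> \<open>The left side drops by at least 6, from \<open>v\<close> and its neighbour
      \<open>n\<close>; the right side drops by 4.\<close>
    ultimately show "3 * (\<Sum>t\<in>?W. ?e t) \<le> 2 * card (A - ?S) + 1"
      using budget one cS by simp
  qed (use residual_subset in auto)
  moreover have "card ?W < card V" using v fin by (intro psubset_card_mono) auto
  ultimately obtain f where f: "transversal (A - ?S \<union> ?W) ?L f"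
    using smaller[of "A - ?S" ?W] cS by fastforce
  have "matched (A - ?S \<union> V) ?L"
    by (rule matched_mono[OF M]) (use residual_subset in auto)
  then have "\<exists>f. transversal (A - ?S \<union> V) ?L f"
    using AV EV[OF _ v(1)] by (intro extend_to_vertex[OF _ _ v(1) _ zero f]) (auto simp: residual_def)
  moreover have "A - ?S \<union> V = A \<union> V - ?S" using ab AV by auto
  ultimately show False using transversal_combine[OF g, of "A \<union> V"] ab no_transversal by fastforce
qed

text \<open>Two coincidences gain 2 for three clique vertices, exactly the ratio 2/3. If
  \<open>u = v\<close>, both gains fall on one vertex, whose excess is large enough by
  \<open>share_excess\<close>.\<close>

lemma no_triple:
  assumes abc: "a \<in> A" "b \<in> A" "c \<in> A" "a \<noteq> b" "a \<noteq> c" "b \<noteq> c"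
    and xyz: "x \<in> L a" "y \<in> L b" "z \<in> L c" "\<not> R x y" "\<not> R x z" "\<not> R y z"
    and uv: "u \<in> V" "v \<in> V" "share u x y" "share v z y"
  shows False
proof -
  let ?S = "{a, b, c}" and ?g = "\<lambda>t. if t = a then x else if t = b then y else z"
  let ?h = "\<lambda>t. (if t = u then 1 else 0) + (if t = v then 1 else 0) :: nat"
  have "(\<Sum>t\<in>V. ?h t) = 2" using fin uv by (simp add: sum.distrib)
  show False
  proof (rule A_step[of ?S ?g ?h])
    fix t assume t: "t \<in> V"
    have all: "card (L t) \<le> card (residual L ?S ?g t) + card ?S"
      using t abc xyz AV by (intro card_list_le_residual[OF M]) auto
    have gu: "card (L t) \<le> card (residual L ?S ?g t) + card {a, c}" if "share t x y"
      using t abc xyz AV share_iff[of t b y x] that share_sym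
      by (intro card_list_le_residual[OF M]) (auto split: if_splits)
    have gv: "card (L t) \<le> card (residual L ?S ?g t) + card {a, b}" if "share t z y"
      using t abc xyz AV share_iff[of t c z y] that share_sym
      by (intro card_list_le_residual[OF M]) (auto split: if_splits)
    \<comment> \<open>Where both coincidences occur, all three representatives delete the same
      element, so \<open>b\<close> alone accounts for the loss.\<close>
    have "card (L t) \<le> card (residual L ?S ?g t) + card {b}" if "share t x y" "share t z y"
      using t abc xyz AV share_iff[of t c z y] share_iff[of t a x y] that
      by (intro card_list_le_residual[OF M]) (auto split: if_splits)
    then show "card (L t) + ?h t \<le> card (residual L ?S ?g t) + card ?S"
      using all gu gv uv abc by auto
  next
    fix t assume "t \<in> V"
    then show "?h t \<le> exc t"
      using excess_pos[of t] share_excess[OF abc(1,2,4) xyz(1,2,4)] uv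
      by (auto simp: Suc_le_eq numeral_2_eq_2)
  next
    show "3 * (\<Sum>v\<in>V. exc v) + 2 * card ?S \<le> 2 * card A + 1 + 3 * (\<Sum>t\<in>V. ?h t)"
      unfolding \<open>(\<Sum>t\<in>V. ?h t) = 2\<close> using budget abc by simp
  qed (use abc xyz R_sym[of y x] R_sym[of z x] R_sym[of z y] in \<open>auto simp: transversal_def\<close>)
qed

text \<open>
  The neighbours of \<open>y\<close> in the lists of a colour class form an independent set.  Choosing
  them costs every clique vertex one element of its list, like a colour in an ordinary colouring,
  except at the clique vertices that are \<open>bad\<close> for the class; these are coloured at once,
  and the excess removed with the class pays for them.
\<close>

definition bad :: "'b \<Rightarrow> 'a \<Rightarrow> 'a \<Rightarrow> bool" where
  "bad y c v \<longleftrightarrow> (\<exists>p\<in>L c. \<not> R p y \<and> share v p y)"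

text \<open>By \<open>no_triple\<close>, a witness of badness at \<open>a\<close> is adjacent to
  every witness at \<open>c\<close>. The matching allows only one such witness at \<open>c\<close>,
  and \<open>share_unique\<close> only one vertex for it.\<close>

lemma bad_unique:
  assumes b: "b \<in> A" "y \<in> L b"
    and ac: "a \<in> A" "c \<in> A" "a \<noteq> b" "c \<noteq> b" "a \<noteq> c"
    and bad: "u \<in> V" "bad y a u" "v \<in> V" "bad y c v" "w \<in> V" "bad y c w"
  shows "v = w"
proof -
  obtain x p q where x: "x \<in> L a" "\<not> R x y" "share u x y"
    and p: "p \<in> L c" "\<not> R p y" "share v p y"
    and q: "q \<in> L c" "\<not> R q y" "share w q y"
    using bad unfolding bad_def by blast
  have "R x p"
    using no_triple[of a b c x y p u v] b ac x p bad R_sym by blast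
  moreover have "R x q"
    using no_triple[of a b c x y q u w] b ac x q bad R_sym by blast
  ultimately have "p = q" using matchedD[OF M, of a c x p q] ac x p q by auto
  then show ?thesis
    using share_unique[of c b p y v w] ac b p q bad by blast
qed

lemma contradiction: False
proof -
  obtain b where b: "b \<in> A" using A_nonempty by blast
  have "card (L b) \<noteq> 0" using LA[OF b] card_col_pos by simp
  then obtain y where y: "y \<in> L b" by fastforce
  \<comment> \<open>\<open>w v\<close> is the neighbour of \<open>y\<close> in \<open>L v\<close>;
    one colour class will be coloured by \<open>w\<close>.\<close>
  obtain w where w: "\<And>v. v \<in> V \<Longrightarrow> w v \<in> L v" "\<And>v. v \<in> V \<Longrightarrow> R y (w v)"
    using neighbour_exists[OF b y] by metis
  define C where "C = {c \<in> A - {b}. \<exists>v\<in>V. bad y c v}"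
  define D where "D i = {c \<in> A - {b}. \<exists>v\<in>V. col v = i \<and> bad y c v}" for i
  define U where "U i = {v \<in> V. col v = i}" for i
  have D_C: "D i \<subseteq> C" for i unfolding C_def D_def by blast
  have finD: "finite (D i)" "finite C" for i using fin unfolding C_def D_def by auto
  have cC: "card C + 1 \<le> card A"
  proof -
    have "card C \<le> card (A - {b})" using fin by (intro card_mono) (auto simp: C_def)
    then show ?thesis using card.remove[OF fin(1) b] by simp
  qed
  have bad_iff: "bad y c v \<longleftrightarrow> (\<exists>p\<in>L c. \<not> R p y \<and> R (w v) p)" if "c \<in> A" "v \<in> V" for c v
  proof -
    have "share v p y \<longleftrightarrow> R (w v) p" for p
      using share_iff[OF that(2) b y, of p "w v"] w[OF that(2)] R_sym share_sym
      unfolding share_def by blast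
    then show ?thesis unfolding bad_def by simp
  qed
  have lost: "card (L c) \<le> card (residual L (U i) w c) + card S'"
    if "c \<in> A" "S' \<subseteq> U i" "\<And>v x. \<lbrakk>v \<in> U i; x \<in> L c; R (w v) x\<rbrakk> \<Longrightarrow> \<exists>v'\<in>S'. R (w v') x" for c i S'
    using that AV w by (intro card_list_le_residual[OF M]) (auto simp: U_def)
  \<comment> \<open>The class \<open>U i\<close> to colour: its excess pays for \<open>D i\<close>,
    and the lists on \<open>D i\<close> stay long enough for \<open>greedy\<close>.\<close>
  have "\<exists>i\<in>col ` V. 2 * card (D i) \<le> 3 * (\<Sum>v\<in>U i. exc v) \<and>
      (\<forall>d\<in>D i. card (D i) \<le> card (residual L (U i) w d))"
  proof (cases "\<exists>a c. a \<in> C \<and> c \<in> C \<and> a \<noteq> c")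
    case False
    then have le1: "card (D i) \<le> 1" for i
      using D_C finD by (auto simp: card_le_Suc0_iff_eq)
    \<comment> \<open>With at most one bad clique vertex any class serves. Even if each vertex of
      the class deletes a different element, \<open>card V \<le> card A\<close> leaves one
      over.\<close>
    obtain v where v: "v \<in> V" using V_nonempty by blast
    let ?i = "col v"
    have "exc v \<le> (\<Sum>v\<in>U ?i. exc v)"
      using v fin by (intro member_le_sum) (auto simp: U_def)
    then have "2 * card (D ?i) \<le> 3 * (\<Sum>v\<in>U ?i. exc v)"
      using le1[of ?i] excess_pos[OF v] by simp
    moreover have "card (D ?i) \<le> card (residual L (U ?i) w d)" if "d \<in> D ?i" for d
    proof -
      have "d \<in> A" using that unfolding D_def by blast
      then have "card (L d) \<le> card (residual L (U ?i) w d) + card (U ?i)"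
        by (intro lost) auto
      moreover have "card (U ?i) \<le> card V" using fin by (intro card_mono) (auto simp: U_def)
      moreover have "card V \<le> card A" using card_V_le budget b fin
        by (cases "card A") auto
      ultimately show ?thesis using LA[OF \<open>d \<in> A\<close>] card_col_pos le1[of ?i] by simp
    qed
    ultimately show ?thesis using v by blast
  next
    case True
    \<comment> \<open>A second bad clique vertex makes \<open>bad_unique\<close> applicable, so each
      is bad at a single vertex and the sets \<open>D i\<close> become disjoint.\<close>
    have uniq: "v = v'" if c: "c \<in> C" and v: "v \<in> V" "bad y c v" "v' \<in> V" "bad y c v'" for c v v'
    proof -
      obtain a where "a \<in> C" "a \<noteq> c" using True by metis
      then show ?thesis using bad_unique[OF b y, of a c _ v v'] c v unfolding C_def by blast
    qed
    have disj: "D i \<inter> D j = {}" if "i \<noteq> j" for i j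
    proof -
      have False if "c \<in> D i" "c \<in> D j" for c
        using uniq[of c] D_C that \<open>i \<noteq> j\<close> unfolding D_def by blast
      then show ?thesis by blast
    qed
    have "(\<Sum>i\<in>col ` V. card (D i)) = card (\<Union>i\<in>col ` V. D i)"
      using fin finD disj by (intro card_UN_disjoint[symmetric]) auto
    also have "\<dots> \<le> card C" using D_C finD by (intro card_mono) auto
    finally have sumD: "(\<Sum>i\<in>col ` V. card (D i)) \<le> card C" .
    have sumU: "(\<Sum>v\<in>V. exc v) = (\<Sum>i\<in>col ` V. \<Sum>v\<in>U i. exc v)"
      unfolding U_def using fin by (intro sum.image_gen)
    \<comment> \<open>Averaging over the classes: if all failed, three times the total excess would
      be at most \<open>2 * card C\<close>, hence below \<open>2 * card A\<close>, against
      \<open>no_slack\<close>.\<close>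
    have "\<exists>i\<in>col ` V. 2 * card (D i) \<le> 3 * (\<Sum>v\<in>U i. exc v)"
    proof (rule ccontr)
      assume "\<not> ?thesis"
      then have "(\<Sum>i\<in>col ` V. 3 * (\<Sum>v\<in>U i. exc v)) \<le> (\<Sum>i\<in>col ` V. 2 * card (D i))"
        by (intro sum_mono) (meson nat_le_linear)
      then have "3 * (\<Sum>v\<in>V. exc v) \<le> 2 * (\<Sum>i\<in>col ` V. card (D i))"
        unfolding sumU sum_distrib_left .
      then show False using sumD cC no_slack by simp
    qed
    then obtain i where i: "i \<in> col ` V" "2 * card (D i) \<le> 3 * (\<Sum>v\<in>U i. exc v)" by blast
    have "card (D i) \<le> card (residual L (U i) w d)" if d: "d \<in> D i" for d
    proof -
      have dA: "d \<in> A" "d \<noteq> b" and "d \<in> C" using d D_C unfolding D_def by auto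
      obtain v where v: "v \<in> V" "col v = i" "bad y d v" using d unfolding D_def by blast
      have v_only: "u = v" if "u \<in> U i" "x \<in> L d" "R (w u) x" "\<not> R x y" for u x
        using uniq[OF \<open>d \<in> C\<close>, of u v] bad_iff[OF dA(1), of u] that v unfolding U_def by blast
      have at_most: "x = x'" if "x \<in> L d" "x' \<in> L d" "R x y" "R x' y" for x x'
        using matchedD[OF M, of b d y x x'] that b y dA R_sym by blast
      \<comment> \<open>Deleted elements of \<open>L d\<close> not adjacent to \<open>y\<close> are
        deleted by \<open>v\<close> only; besides them there is at most one, the neighbour of
        \<open>y\<close>. So two vertices account for all.\<close>
      have "\<exists>S'\<subseteq>U i. card S' \<le> 2 \<and> (\<forall>u\<in>U i. \<forall>x\<in>L d. R (w u) x \<longrightarrow> (\<exists>u'\<in>S'. R (w u') x))"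
      proof (cases "\<exists>u\<in>U i. \<exists>x\<in>L d. R (w u) x \<and> R x y")
        case True
        then obtain u x where u: "u \<in> U i" "x \<in> L d" "R (w u) x" "R x y" by blast
        have "\<forall>u'\<in>U i. \<forall>z\<in>L d. R (w u') z \<longrightarrow> (\<exists>u''\<in>{u, v}. R (w u'') z)"
          using v_only at_most u by blast
        moreover have "card {u, v} \<le> 2" by (simp add: card_insert_if)
        moreover have "{u, v} \<subseteq> U i" using u v unfolding U_def by auto
        ultimately show ?thesis by blast
      next
        case False
        then have "\<forall>u'\<in>U i. \<forall>z\<in>L d. R (w u') z \<longrightarrow> (\<exists>u''\<in>{v}. R (w u'') z)"
          using v_only by blast
        moreover have "{v} \<subseteq> U i" "card {v} \<le> 2" using v unfolding U_def by auto
        ultimately show ?thesis by blast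
      qed
      then obtain S' where S': "S' \<subseteq> U i" "card S' \<le> 2"
        "\<forall>u\<in>U i. \<forall>x\<in>L d. R (w u) x \<longrightarrow> (\<exists>u'\<in>S'. R (w u') x)" by blast
      then have "card (L d) \<le> card (residual L (U i) w d) + card S'"
        using dA by (intro lost) auto
      moreover have "card (D i) \<le> card C" using D_C finD by (intro card_mono) auto
      \<comment> \<open>At least \<open>card A + 1 - 2\<close> elements remain, which is enough
        because \<open>b\<close> lies outside \<open>C\<close>.\<close>
      ultimately show ?thesis using LA[OF dA(1)] card_col_pos cC S' by simp
    qed
    then show ?thesis using i by blast
  qed
  then obtain i where i: "i \<in> col ` V" "2 * card (D i) \<le> 3 * (\<Sum>v\<in>U i. exc v)"
    and big: "\<And>d. d \<in> D i \<Longrightarrow> card (D i) \<le> card (residual L (U i) w d)" by blast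
  let ?L1 = "residual L (U i) w"
  have DA: "D i \<subseteq> A" and UV: "U i \<subseteq> V" unfolding D_def U_def by auto
  have M1: "matched (A \<union> V) ?L1"
    by (rule matched_mono[OF M]) (auto simp: residual_def)
  obtain g where g: "transversal (D i) ?L1 g"
    using greedy[OF finD(1), of i ?L1] matched_mono[OF M1, of "D i" ?L1] DA big by blast
  let ?L2 = "residual ?L1 (D i) g"
  have tw: "transversal (U i) L w"
    unfolding transversal_def
  proof (intro conjI ballI impI)
    fix u v assume uv: "u \<in> U i" "v \<in> U i" "u \<noteq> v"
    then have "\<not> E u v" using col[of u v] unfolding U_def by auto
    then show "\<not> R (w u) (w v)" using EV[of u v "w u" "w v"] uv w UV by blast
  qed (use w UV in blast)
  have card_A: "card (A - D i) = card A - card (D i)" "card (D i) \<le> card A"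
    using DA fin finD by (auto intro: card_Diff_subset card_mono)
  have step2: "card (?L1 t) \<le> card (?L2 t) + card (D i)" if "t \<in> A \<union> V" "t \<notin> D i" for t
    using that DA g by (intro card_list_le_residual[OF M1]) (auto simp: transversal_def)
  have "admissible (A - D i) (V - U i) ?L2"
  proof (rule admissible_restrict)
    fix c assume c: "c \<in> A - D i"
    obtain v0 where v0: "v0 \<in> U i" using i unfolding U_def by auto
    \<comment> \<open>One lost element per list is offset by the lost colour. In \<open>L b\<close>
      only \<open>y\<close> can be deleted; in any other remaining clique list only the neighbour of
      \<open>y\<close>, since \<open>c\<close> is not bad for the class.\<close>
    have "\<exists>S'\<subseteq>U i. card S' \<le> 1 \<and> (\<forall>u\<in>U i. \<forall>x\<in>L c. R (w u) x \<longrightarrow> (\<exists>u'\<in>S'. R (w u') x))"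
    proof (cases "c = b")
      case True
      have "x = y" if "u \<in> U i" "x \<in> L b" "R (w u) x" for u x
        using matchedD[OF M, of u b "w u" x y] that w[of u] b y R_sym AV unfolding U_def by blast
      moreover have "R (w v0) y" using v0 w R_sym unfolding U_def by blast
      ultimately have "\<forall>u\<in>U i. \<forall>x\<in>L c. R (w u) x \<longrightarrow> (\<exists>u'\<in>{v0}. R (w u') x)"
        using True by blast
      then show ?thesis using v0 by (intro exI[of _ "{v0}"]) auto
    next
      case False
      have only: "R x y" if "u \<in> U i" "x \<in> L c" "R (w u) x" for u x
        using that bad_iff[of c u] c False unfolding U_def D_def by blast
      have at_most: "x = x'" if "x \<in> L c" "x' \<in> L c" "R x y" "R x' y" for x x'
        using matchedD[OF M, of b c y x x'] that b y c False R_sym by blast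
      show ?thesis
      proof (cases "\<exists>u\<in>U i. \<exists>x\<in>L c. R (w u) x")
        case True
        then obtain u x where u: "u \<in> U i" "x \<in> L c" "R (w u) x" by blast
        then have "\<forall>u'\<in>U i. \<forall>z\<in>L c. R (w u') z \<longrightarrow> (\<exists>u''\<in>{u}. R (w u'') z)"
          using only at_most by blast
        then show ?thesis using u by (intro exI[of _ "{u}"]) auto
      next
        case False
        then show ?thesis by (intro exI[of _ "{}"]) auto
      qed
    qed
    then obtain S' where S': "S' \<subseteq> U i" "card S' \<le> 1"
      "\<forall>u\<in>U i. \<forall>x\<in>L c. R (w u) x \<longrightarrow> (\<exists>u'\<in>S'. R (w u') x)" by blast
    then have "card (L c) \<le> card (?L1 c) + card S'" using c by (intro lost) auto
    moreover have "col ` (V - U i) = col ` V - {i}" unfolding U_def by auto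
    then have "card (col ` (V - U i)) = card (col ` V) - 1"
      using i fin by (simp add: card_Diff_singleton)
    ultimately show "card (A - D i) + card (col ` (V - U i)) \<le> card (?L2 c)"
      using LA[of c] c step2[of c] S' card_col_pos card_A by simp
  next
    have "excess (A - D i) (V - U i) ?L2 u \<le> exc u" if u: "u \<in> V - U i" for u
    proof -
      \<comment> \<open>Elements lost to the class are offset by the drop in degree, those lost to
        \<open>D i\<close> by the smaller clique, so no excess grows.\<close>
      let ?N = "{v \<in> U i. E u v}"
      have "card (L u) \<le> card (?L1 u) + card ?N"
      proof (rule card_list_le_residual[OF M])
        fix s x assume "s \<in> U i" "x \<in> L u" "R (w s) x"
        then have "s \<in> ?N" using EV[of s u "w s" x] E_sym u w UV by blast
        then show "\<exists>s'\<in>?N. R (w s') x" using \<open>R (w s) x\<close> by blast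
      qed (use u w UV in auto)
      moreover have "deg V u = deg (V - U i) u + card ?N"
      proof -
        have "{v \<in> V. E u v} = {v \<in> V - U i. E u v} \<union> ?N" using UV by auto
        then show ?thesis unfolding deg_def
          using fin UV by (simp add: card_Un_disjoint finite_subset disjoint_iff)
      qed
      moreover have "u \<notin> D i" using u DA AV by blast
      ultimately show ?thesis using step2[of u] u card_A unfolding excess_def by simp
    qed
    then have "(\<Sum>u\<in>V - U i. excess (A - D i) (V - U i) ?L2 u) \<le> (\<Sum>u\<in>V - U i. exc u)"
      by (rule sum_mono)
    moreover have "(\<Sum>u\<in>V. exc u) = (\<Sum>u\<in>V - U i. exc u) + (\<Sum>u\<in>U i. exc u)"
      by (rule sum.subset_diff[OF UV fin(2)])
    ultimately show "3 * (\<Sum>u\<in>V - U i. excess (A - D i) (V - U i) ?L2 u) \<le> 2 * card (A - D i) + 1"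
      using budget i card_A by simp
  qed (auto simp: residual_def)
  moreover have "card (V - U i) < card V"
    using i fin by (intro psubset_card_mono) (auto simp: U_def)
  ultimately obtain f where f: "transversal (A - D i \<union> (V - U i)) ?L2 f"
    using smaller[of "A - D i" "V - U i"] card_A by fastforce
  have sets: "A - D i \<union> (V - U i) = A \<union> V - U i - D i" "D i \<subseteq> A \<union> V - U i"
    using DA UV AV by auto
  obtain f' where "transversal (A \<union> V - U i) ?L1 f'"
    using transversal_combine[OF g _ sets(2)] f unfolding sets(1) by blast
  then show False using transversal_combine[OF tw, of "A \<union> V"] UV no_transversal by blast
qed

end

section \<open>Existence of transversals by induction\<close>

context list_conflicts
begin

theorem admissible_imp_transversal:
  "admissible A V L \<Longrightarrow> \<exists>f. transversal (A \<union> V) L f"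
proof (induction "card A + card V" arbitrary: A V L rule: less_induct)
  case less
  show ?case
  proof (rule ccontr)
    assume none: "\<not> ?thesis"
    interpret critical R E col A V L
    proof unfold_locales
      show "\<exists>f. transversal (A' \<union> V') L' f"
        if "admissible A' V' L'" "card A' + card V' < card A + card V" for A' V' L'
        using less.hyps[OF that(2,1)] .
    qed (fact less.prems none)+
    show False by (rule contradiction)
  qed
qed

end

section \<open>Graphs, joins and covers\<close>

lemma simple_graph_edgeD:
  assumes "simple_graph G" "{u, v} \<in> edges G"
  shows "u \<in> verts G" "v \<in> verts G" "u \<noteq> v"
  using assms unfolding simple_graph_def by (auto simp: card_insert_if split: if_splits)

lemma finite_edges: "simple_graph G \<Longrightarrow> finite (edges G)"
  unfolding simple_graph_def by (rule finite_subset[of _ "Pow (verts G)"]) auto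

lemma handshake:
  assumes "simple_graph G"
  shows "(\<Sum>v\<in>verts G. degree G v) = 2 * card (edges G)"
proof -
  have "card {v \<in> verts G. v \<in> e} = 2" if "e \<in> edges G" for e
  proof -
    have "{v \<in> verts G. v \<in> e} = e" using assms that unfolding simple_graph_def by blast
    then show ?thesis using assms that unfolding simple_graph_def by simp
  qed
  then have "(\<Sum>v\<in>verts G. degree G v) = (\<Sum>e\<in>edges G. 2)"
    unfolding degree_def using assms finite_edges[OF assms]
    by (intro sum_multicount_gen) (auto simp: simple_graph_def)
  then show ?thesis by simp
qed

lemma degree_eq_card_neighbours:
  assumes "simple_graph G"
  shows "degree G v = card {u \<in> verts G. {v, u} \<in> edges G}"
proof -
  have "inj_on (\<lambda>u. {v, u}) {u \<in> verts G. {v, u} \<in> edges G}"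
    by (auto intro!: inj_onI simp: doubleton_eq_iff)
  moreover have "(\<lambda>u. {v, u}) ` {u \<in> verts G. {v, u} \<in> edges G} = {e \<in> edges G. v \<in> e}"
  proof (intro equalityI subsetI)
    fix e assume e: "e \<in> {e \<in> edges G. v \<in> e}"
    then have "card e = 2" "e \<subseteq> verts G" using assms unfolding simple_graph_def by auto
    then obtain x y where "e = {x, y}" "x \<noteq> y" by (auto simp: card_2_iff)
    then obtain u where "e = {v, u}" using e by auto
    then show "e \<in> (\<lambda>u. {v, u}) ` {u \<in> verts G. {v, u} \<in> edges G}"
      using e \<open>e \<subseteq> verts G\<close> by auto
  qed auto
  ultimately show ?thesis
    unfolding degree_def
    using card_image[of "\<lambda>u. {v, u}" "{u \<in> verts G. {v, u} \<in> edges G}"] by simp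
qed

text \<open>Giving all vertices distinct colours shows that the minimum is attained.\<close>

lemma colorable_chromatic_number:
  assumes "simple_graph G" shows "colorable G (chromatic_number G)"
proof -
  obtain f :: "'a \<Rightarrow> nat" and n where "f ` verts G = {i. i < n}" "inj_on f (verts G)"
    using assms finite_imp_inj_to_nat_seg[of "verts G"] unfolding simple_graph_def by blast
  then have "colorable G n"
    unfolding colorable_def using simple_graph_edgeD[OF assms]
    by (intro exI[of _ f]) (auto simp: inj_on_def, blast)
  then show ?thesis unfolding chromatic_number_def by (rule LeastI)
qed

section \<open>The join and its colourings\<close>

lemma verts_join_complete: "verts (join_complete G s) = Inl ` verts G \<union> Inr ` {..<s}"
  by (simp add: join_complete_def)

lemma Inl_Inl_in_join: "{Inl u, Inl v} \<in> edges (join_complete G s) \<longleftrightarrow> {u, v} \<in> edges G"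
proof -
  have "{Inl u, Inl v} = Inl ` {u, v}" by simp
  then have "{Inl u, Inl v} \<in> (\<lambda>e. Inl ` e) ` edges G \<longleftrightarrow> {u, v} \<in> edges G"
    by (metis (no_types, lifting) imageE image_eqI inj_Inl inj_image_eq_iff)
  then show ?thesis unfolding join_complete_def by (auto simp: doubleton_eq_iff)
qed

lemma Inr_Inr_in_join: "{Inr i, Inr j} \<in> edges (join_complete G s) \<longleftrightarrow> i < s \<and> j < s \<and> i \<noteq> j"
  unfolding join_complete_def by (auto simp: doubleton_eq_iff)

lemma Inl_Inr_in_join: "{Inl u, Inr i} \<in> edges (join_complete G s) \<longleftrightarrow> u \<in> verts G \<and> i < s"
  unfolding join_complete_def by (auto simp: doubleton_eq_iff)

lemma simple_graph_join_complete:
  assumes "simple_graph G" shows "simple_graph (join_complete G s)"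
proof -
  have "card (Inl ` e :: ('a + nat) set) = card e" for e :: "'a set"
    by (intro card_image) simp
  then show ?thesis
    using assms unfolding simple_graph_def join_complete_def by auto
qed

text \<open>The added vertices use \<open>s\<close> distinct colours, none of which recurs on
  \<open>G\<close>; renumbering the other \<open>d - s\<close> colours gives a colouring of
  \<open>G\<close>.\<close>

lemma chromatic_number_join_ge:
  fixes G :: "'a ugraph"
  assumes G: "simple_graph G" and "colorable (join_complete G s) d"
  shows "s + chromatic_number G \<le> d"
proof -
  obtain f where f: "\<And>t. t \<in> verts (join_complete G s) \<Longrightarrow> f t < d"
    "\<And>t t'. {t, t'} \<in> edges (join_complete G s) \<Longrightarrow> f t \<noteq> f t'"
    using assms unfolding colorable_def by blast
  let ?B = "(\<lambda>i. f (Inr i)) ` {..<s}"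
  have "inj_on (\<lambda>i. f (Inr i)) {..<s}"
    using f(2) Inr_Inr_in_join[of _ _ G s] unfolding inj_on_def by blast
  then have cB: "card ?B = s" by (simp add: card_image)
  have B: "?B \<subseteq> {..<d}" using f(1) by (auto simp: verts_join_complete)
  then have "s \<le> d" using card_mono[OF _ B] cB by simp
  have card_free: "card ({..<d} - ?B) = d - s" using B cB by (simp add: card_Diff_subset)
  have "\<exists>h. bij_betw h ({..<d} - ?B) {0..<card ({..<d} - ?B)}"
    by (rule ex_bij_betw_finite_nat) simp
  then obtain h where h: "bij_betw h ({..<d} - ?B) {0..<d - s}"
    unfolding card_free by blast
  have mem: "f (Inl v) \<in> {..<d} - ?B" if "v \<in> verts G" for v
  proof -
    have "f (Inl v) \<noteq> f (Inr i)" if "i < s" for i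
      using f(2)[of "Inl v" "Inr i"] Inl_Inr_in_join[of v i G s] that \<open>v \<in> verts G\<close> by simp
    moreover have "f (Inl v) < d" using f(1) that by (simp add: verts_join_complete)
    ultimately show ?thesis by auto
  qed
  have "colorable G (d - s)"
    unfolding colorable_def
  proof (intro exI[of _ "\<lambda>v. h (f (Inl v))"] conjI ballI allI impI)
    fix v assume "v \<in> verts G"
    then have "h (f (Inl v)) \<in> {0..<d - s}" using bij_betwE[OF h] mem by blast
    then show "h (f (Inl v)) < d - s" by simp
  next
    fix u v assume uv: "{u, v} \<in> edges G"
    then have "f (Inl u) \<noteq> f (Inl v)"
      using f(2)[of "Inl u" "Inl v"] Inl_Inl_in_join[of u v G s] by simp
    then show "h (f (Inl u)) \<noteq> h (f (Inl v))"
      using mem simple_graph_edgeD[OF G uv] bij_betw_imp_inj_on[OF h] by (metis inj_onD)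
  qed
  then have "chromatic_number G \<le> d - s" unfolding chromatic_number_def by (rule Least_le)
  then show ?thesis using \<open>s \<le> d\<close> by simp
qed

text \<open>A colouring with \<open>d\<close> colours is a colouring of the cover by \<open>d\<close> parallel copies of \<open>G\<close>.\<close>

lemma DP_colorable_imp_colorable:
  fixes G :: "'a ugraph"
  assumes G: "simple_graph G" and DP: "DP_colorable G d"
  shows "colorable G d"
proof -
  obtain e :: "'a \<Rightarrow> nat" where e: "inj_on e (verts G)"
    using G finite_imp_inj_to_nat_seg[of "verts G"] unfolding simple_graph_def by blast
  \<comment> \<open>\<open>DP_colorable\<close> ranges over covers whose vertices are natural
    numbers, so copy \<open>i\<close> of \<open>u\<close> is encoded as one.\<close>
  define p where "p u i = prod_encode (e u, i)" for u i
  have p_eq: "p u i = p v j \<longleftrightarrow> u = v \<and> i = j" if "u \<in> verts G" "v \<in> verts G" for u v i j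
    using that e unfolding p_def by (auto dest: inj_onD)
  define L where "L u = p u ` {..<d}" for u
  define F where "F = {{p u i, p v j} | u v i j. u \<in> verts G \<and> v \<in> verts G \<and> i < d \<and> j < d \<and>
    ({u, v} \<in> edges G \<and> i = j \<or> u = v \<and> i \<noteq> j)}"
  define H where "H = \<lparr> verts = (\<Union>u\<in>verts G. L u), edges = F \<rparr>"
  have verts_H: "verts H = (\<Union>u\<in>verts G. L u)" and edges_H: "edges H = F"
    by (simp_all add: H_def)
  have edge: "{p u i, p v j} \<in> edges H \<longleftrightarrow> {u, v} \<in> edges G \<and> i = j \<or> u = v \<and> i \<noteq> j"
    if "u \<in> verts G" "v \<in> verts G" "i < d" "j < d" for u v i j
  proof -
    have "{u, v} \<in> edges G \<and> i = j \<or> u = v \<and> i \<noteq> j" if "{p u i, p v j} \<in> edges H"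
      using that \<open>u \<in> verts G\<close> \<open>v \<in> verts G\<close>
      unfolding edges_H F_def by (auto simp: doubleton_eq_iff p_eq insert_commute)
    then show ?thesis using that unfolding edges_H F_def by blast
  qed
  have no_loop: "\<not> ({u, u} \<in> edges G)" for u using simple_graph_edgeD[OF G] by blast
  have "simple_graph H"
  proof -
    have "finite (verts H)" using G unfolding verts_H L_def simple_graph_def by auto
    moreover have "E \<subseteq> verts H \<and> card E = 2" if edge_E: "E \<in> edges H" for E
    proof -
      obtain u v i j where E: "E = {p u i, p v j}"
        "u \<in> verts G" "v \<in> verts G" "i < d" "j < d"
        "{u, v} \<in> edges G \<and> i = j \<or> u = v \<and> i \<noteq> j"
        using edge_E unfolding edges_H F_def by blast
      then have "p u i \<noteq> p v j" using p_eq no_loop by auto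
      then show ?thesis using E unfolding verts_H L_def by auto
    qed
    ultimately show ?thesis unfolding simple_graph_def by blast
  qed
  moreover have "disjoint_family_on L (verts G)"
    unfolding disjoint_family_on_def L_def using p_eq by blast
  moreover have "v = u \<or> {u, v} \<in> edges G"
    if "u \<in> verts G" "v \<in> verts G" "\<exists>x\<in>L u. \<exists>y\<in>L v. {x, y} \<in> edges H" for u v
    using that edge unfolding L_def by auto
  moreover have "{x, y} \<in> edges H" if "u \<in> verts G" "x \<in> L u" "y \<in> L u" "x \<noteq> y" for u x y
    using that edge unfolding L_def by auto
  moreover have "disjoint (edges_between H (L u) (L v))" if uv: "{u, v} \<in> edges G" for u v
  proof -
    have mem: "u \<in> verts G" "v \<in> verts G" "u \<noteq> v" using simple_graph_edgeD[OF G uv] by auto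
    have "\<exists>i. E = {p u i, p v i}" if "E \<in> edges_between H (L u) (L v)" for E
      using that edge mem unfolding edges_between_def L_def by auto
    moreover have "{p u i, p v i} \<inter> {p u j, p v j} = {}" if "i \<noteq> j" for i j
      using that p_eq mem by simp
    ultimately show ?thesis unfolding disjoint_def by metis
  qed
  ultimately have "cover G L H" unfolding cover_def verts_H by blast
  moreover have "d \<le> card (L u)" if "u \<in> verts G" for u
    unfolding L_def using p_eq[OF that that] by (subst card_image) (auto intro: inj_onI)
  ultimately obtain I where I: "cover_coloring G L H I" using DP unfolding DP_colorable_def by blast
  have "\<exists>i<d. p u i \<in> I" if "u \<in> verts G" for u
  proof -
    have "card (I \<inter> L u) = 1" using I that unfolding cover_coloring_def by blast
    then obtain x where "I \<inter> L u = {x}" by (rule card_1_singletonE)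
    then have "x \<in> I" "x \<in> L u" by auto
    then show ?thesis unfolding L_def by auto
  qed
  then obtain f where f: "\<And>u. u \<in> verts G \<Longrightarrow> f u < d \<and> p u (f u) \<in> I" by metis
  have "f u \<noteq> f v" if uv: "{u, v} \<in> edges G" for u v
  proof
    assume "f u = f v"
    then have "{p u (f u), p v (f v)} \<in> edges H"
      using simple_graph_edgeD[OF G uv] f edge uv by simp
    then show False
      using I f simple_graph_edgeD[OF G uv] unfolding cover_coloring_def independent_set_def by blast
  qed
  then show ?thesis unfolding colorable_def using f by blast
qed

text \<open>The added clique serves as \<open>A\<close> and the copy of \<open>G\<close> as
  \<open>V\<close>. With lists of size at least \<open>s + k\<close>, the excess of \<open>v\<close>
  is at most \<open>degree G v + 1 - k\<close>, and the bound on \<open>s\<close> becomes the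
  budget.\<close>

lemma DP_colorable_join:
  fixes G :: "'a ugraph"
  assumes G: "simple_graph G" and col: "colorable G k"
    and s: "3 * (\<Sum>v\<in>verts G. degree G v + 1 - k) \<le> 2 * s + 1"
  shows "DP_colorable (join_complete G s) (s + k)"
  unfolding DP_colorable_def
proof (intro allI impI)
  fix L :: "'a + nat \<Rightarrow> nat set" and H :: "nat ugraph"
  let ?J = "join_complete G s" and ?V = "Inl ` verts G :: ('a + nat) set"
    and ?A = "Inr ` {..<s} :: ('a + nat) set"
  assume asm: "cover ?J L H \<and> (\<forall>u\<in>verts ?J. s + k \<le> card (L u))"
  have J: "verts ?J = ?A \<union> ?V" by (auto simp: verts_join_complete)
  have H: "simple_graph H" and LH: "(\<Union>u\<in>?A \<union> ?V. L u) = verts H"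
    and disj: "disjoint_family_on L (?A \<union> ?V)"
    and join: "\<And>u v x y. \<lbrakk>u \<in> ?A \<union> ?V; v \<in> ?A \<union> ?V; u \<noteq> v; x \<in> L u; y \<in> L v; {x, y} \<in> edges H\<rbrakk>
      \<Longrightarrow> {u, v} \<in> edges ?J"
    and mat: "\<And>u v. {u, v} \<in> edges ?J \<Longrightarrow> disjoint (edges_between H (L u) (L v))"
    using asm unfolding cover_def J by blast+
  have size: "\<And>u. u \<in> ?A \<union> ?V \<Longrightarrow> s + k \<le> card (L u)" using asm unfolding J by blast
  obtain f where f: "\<And>v. v \<in> verts G \<Longrightarrow> f v < k" "\<And>u v. {u, v} \<in> edges G \<Longrightarrow> f u \<noteq> f v"
    using col unfolding colorable_def by blast
  let ?R = "\<lambda>x y. {x, y} \<in> edges H"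
  \<comment> \<open>Since \<open>?E\<close> relates only vertices coming from \<open>G\<close>, the
    colouring is proper whatever \<open>projl\<close> yields on an added vertex.\<close>
  let ?E = "\<lambda>t t' :: 'a + nat. isl t \<and> isl t' \<and> {projl t, projl t'} \<in> edges G"
  interpret list_conflicts ?R ?E "\<lambda>t. f (projl t)"
    by unfold_locales (use f in \<open>auto simp: insert_commute\<close>)
  have fin: "finite (verts G)" using G unfolding simple_graph_def by blast
  have "admissible ?A ?V L"
    unfolding admissible_def
  proof (intro conjI)
    have finL: "finite (L t)" if "t \<in> ?A \<union> ?V" for t
      using H LH that unfolding simple_graph_def by (metis UN_upper finite_subset)
    have "y = y'" if t: "t \<in> ?A \<union> ?V" "t' \<in> ?A \<union> ?V" "t \<noteq> t'"
      and x: "x \<in> L t" "y \<in> L t'" "y' \<in> L t'" "?R x y" "?R x y'" for t t' x y y'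
    proof -
      have "disjoint (edges_between H (L t) (L t'))" using mat join t x by blast
      moreover have "{x, y} \<in> edges_between H (L t) (L t')" "{x, y'} \<in> edges_between H (L t) (L t')"
        using x unfolding edges_between_def by blast+
      moreover have "{x, y} \<inter> {x, y'} \<noteq> {}" by simp
      ultimately have "{x, y} = {x, y'}" unfolding disjoint_def by metis
      then show ?thesis by (auto simp: doubleton_eq_iff)
    qed
    then show "matched (?A \<union> ?V) L" unfolding matched_def using finL fin by blast
    show "\<forall>u\<in>?V. \<forall>v\<in>?V. u \<noteq> v \<longrightarrow> (\<forall>x\<in>L u. \<forall>y\<in>L v. ?R x y \<longrightarrow> ?E u v)"
    proof (intro ballI impI)
      fix u v x y assume uv: "u \<in> ?V" "v \<in> ?V" "u \<noteq> v" "x \<in> L u" "y \<in> L v" "?R x y"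
      then have "{u, v} \<in> edges ?J" using join by blast
      then show "?E u v" using uv by (auto simp: Inl_Inl_in_join)
    qed
    have card_A: "card ?A = s" by (simp add: card_image)
    have "card ((\<lambda>t. f (projl t)) ` ?V) \<le> card {..<k}" using f by (intro card_mono) auto
    then show "\<forall>a\<in>?A. card ?A + card ((\<lambda>t. f (projl t)) ` ?V) \<le> card (L a)"
      using size unfolding card_A by fastforce
    have "(\<Sum>t\<in>?V. excess ?A ?V L t) = (\<Sum>v\<in>verts G. excess ?A ?V L (Inl v))"
      by (subst sum.reindex) auto
    also have "\<dots> \<le> (\<Sum>v\<in>verts G. degree G v + 1 - k)"
    proof (rule sum_mono)
      fix v assume v: "v \<in> verts G"
      have "{t \<in> ?V. ?E (Inl v) t} = Inl ` {u \<in> verts G. {v, u} \<in> edges G}" by auto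
      then have "deg ?V (Inl v) = degree G v"
        unfolding deg_def degree_eq_card_neighbours[OF G] by (simp add: card_image)
      then show "excess ?A ?V L (Inl v) \<le> degree G v + 1 - k"
        using size[of "Inl v"] v card_A unfolding excess_def by simp
    qed
    finally show "3 * (\<Sum>t\<in>?V. excess ?A ?V L t) \<le> 2 * card ?A + 1" using s card_A by simp
  qed auto
  then obtain g where "transversal (?A \<union> ?V) L g" using admissible_imp_transversal by blast
  then have g: "\<And>t. t \<in> ?A \<union> ?V \<Longrightarrow> g t \<in> L t"
    "\<And>t t'. \<lbrakk>t \<in> ?A \<union> ?V; t' \<in> ?A \<union> ?V; t \<noteq> t'\<rbrakk> \<Longrightarrow> \<not> ?R (g t) (g t')"
    unfolding transversal_def by auto
  have "independent_set H (g ` (?A \<union> ?V))"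
    unfolding independent_set_def
  proof (intro conjI ballI)
    show "g ` (?A \<union> ?V) \<subseteq> verts H" using g(1) LH by blast
    fix x y assume "x \<in> g ` (?A \<union> ?V)" "y \<in> g ` (?A \<union> ?V)"
    then show "{x, y} \<notin> edges H" using g(2) simple_graph_edgeD(3)[OF H] by blast
  qed
  moreover have "card (g ` (?A \<union> ?V) \<inter> L t) = 1" if t: "t \<in> ?A \<union> ?V" for t
  proof -
    have "t' = t" if "t' \<in> ?A \<union> ?V" "g t' \<in> L t" for t'
      using disjoint_family_onD[OF disj that(1) t] g(1)[OF that(1)] that(2) by blast
    then have "g ` (?A \<union> ?V) \<inter> L t = {g t}" using g(1)[OF t] t by blast
    then show ?thesis by simp
  qed
  ultimately have "cover_coloring ?J L H (g ` (?A \<union> ?V))"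
    unfolding cover_coloring_def J by simp
  then show "\<exists>I. cover_coloring ?J L H I" by blast
qed

text \<open>\<open>s + chromatic_number G\<close> bounds the DP-chromatic number from above and the
  chromatic number from below; the latter never exceeds the former, by the cover with parallel
  copies.\<close>

lemma join_chromatic_numbers_eq:
  assumes G: "simple_graph G"
    and s: "3 * (\<Sum>v\<in>verts G. degree G v + 1 - chromatic_number G) \<le> 2 * s + 1"
  shows "DP_chromatic_number (join_complete G s) = chromatic_number (join_complete G s)"
proof -
  let ?J = "join_complete G s"
  have J: "simple_graph ?J" by (rule simple_graph_join_complete[OF G])
  have DP: "DP_colorable ?J (s + chromatic_number G)"
    using DP_colorable_join[OF G colorable_chromatic_number[OF G] s] .
  have "DP_chromatic_number ?J \<le> s + chromatic_number G"
    unfolding DP_chromatic_number_def using DP by (rule Least_le)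
  also have "\<dots> \<le> chromatic_number ?J"
    using chromatic_number_join_ge[OF G colorable_chromatic_number[OF J]] .
  finally have "DP_chromatic_number ?J \<le> chromatic_number ?J" .
  moreover have "DP_colorable ?J (DP_chromatic_number ?J)"
    unfolding DP_chromatic_number_def using DP by (rule LeastI)
  then have "chromatic_number ?J \<le> DP_chromatic_number ?J"
    unfolding chromatic_number_def
    using DP_colorable_imp_colorable[OF J] by (intro Least_le)
  ultimately show ?thesis by simp
qed

theorem theorem1p5:
  fixes G :: "'a ugraph" and n m k :: nat
  assumes "simple_graph G"
    and "card (verts G) = n" and "card (edges G) = m" and "chromatic_number G = k"
  shows "(\<exists>s. DP_chromatic_number (join_complete G s) = chromatic_number (join_complete G s)) \<and>
         Z_DP G \<le> 3 * m \<and>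
         (real (min_degree G) \<ge> real k - 1 \<longrightarrow>
            real (Z_DP G) \<le> 3 * real m - 3 / 2 * (real k - 1) * real n)"
proof -
  note G = assms(1)
  have fin: "finite (verts G)" using G unfolding simple_graph_def by blast
  have k_pos: "1 \<le> k" if "v \<in> verts G" for v
    using colorable_chromatic_number[OF G] that assms(4) unfolding colorable_def by fastforce
  have Z_le: "Z_DP G \<le> s"
    if "3 * (\<Sum>v\<in>verts G. degree G v + 1 - k) \<le> 2 * s + 1" for s
    unfolding Z_DP_def using join_chromatic_numbers_eq[OF G] that assms(4) by (intro Least_le) simp
  \<comment> \<open>A graph with a vertex needs a colour, so no term exceeds the degree.\<close>
  have "(\<Sum>v\<in>verts G. degree G v + 1 - k) \<le> (\<Sum>v\<in>verts G. degree G v)"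
    using k_pos by (intro sum_mono) (metis add_le_cancel_left le_diff_conv)
  then have basic: "3 * (\<Sum>v\<in>verts G. degree G v + 1 - k) \<le> 2 * (3 * m) + 1"
    using handshake[OF G] assms(3) by simp
  have "real (Z_DP G) \<le> 3 * real m - 3 / 2 * (real k - 1) * real n"
    if md: "real (min_degree G) \<ge> real k - 1"
  proof -
    let ?x = "\<Sum>v\<in>verts G. degree G v + 1 - k"
    have "k \<le> degree G v + 1" if "v \<in> verts G" for v
    proof -
      have "min_degree G \<le> degree G v" unfolding min_degree_def using that fin by (intro Min_le) auto
      then show ?thesis using md by linarith
    qed
    \<comment> \<open>The degree condition makes every truncated difference exact.\<close>
    then have "real ?x = (\<Sum>v\<in>verts G. real (degree G v) - (real k - 1))"
      unfolding of_nat_sum by (intro sum.cong) (auto simp: of_nat_diff)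
    also have "\<dots> = real (\<Sum>v\<in>verts G. degree G v) - (real k - 1) * real n"
      using assms(2) by (simp add: sum_subtractf)
    finally have x: "real ?x = 2 * real m - (real k - 1) * real n"
      using handshake[OF G] assms(3) by simp
    \<comment> \<open>The additive 1 in the budget permits rounding down here.\<close>
    have "Z_DP G \<le> 3 * ?x div 2" by (rule Z_le) linarith
    then have "real (2 * Z_DP G) \<le> real (3 * ?x)" by (intro of_nat_mono) linarith
    then show ?thesis using x by (simp add: field_simps)
  qed
  then show ?thesis
    using join_chromatic_numbers_eq[OF G] Z_le[OF basic] basic assms(4) by blast
qed

end
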